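(* For $\ell=1,2$ let $(\mathcal{S}_\ell,\boldsymbol{d}_{\mathcal{S}_\ell})$ be a Polish metric space, $p_\ell\ge1$, $\mu_\ell\in\mathcal{P}_{p_\ell}(\mathcal{S}_\ell)$, and $c_\ell(s_\ell,s_\ell')=\boldsymbol{d}_{\mathcal{S}_\ell}(s_\ell,s_\ell')^{p_\ell}$. Let $\mathcal{V}=\mathcal{S}_1\times\mathcal{S}_2$ and let $g:\mathcal{V}\to\mathbb{R}$ be measurable with $\int_{\mathcal{V}} g\,d\gamma_0>-\infty$ for some $\gamma_0\in\Pi(\mu_1,\mu_2)$. Then for all $\delta\in\mathbb{R}_{++}^2$, $\mathcal{I}_{\mathrm{D}}(\delta)<\infty$ if and only if there exist $v^\star=(s_1^\star,s_2^\star)\in\mathcal{V}$ and a constant $M>0$ such that for all $(s_1,s_2)\in\mathcal{V}$, $$g(s_1,s_2)\le M\left[1+\boldsymbol{d}_{\mathcal{S}_1}(s_1^\star,s_1)^{p_1}+\boldsymbol{d}_{\mathcal{S}_2}(s_2^\star,s_2)^{p_2}\right].$$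
   Context: $\mathcal{P}(\cdot)$ is the set of Borel probability measures; $\mathcal{P}_p(\mathcal{X})$ is the set of $\mu\in\mathcal{P}(\mathcal{X})$ with $\int\boldsymbol{d}(x_0,x)^p\,d\mu(x)<\infty$ for some (any) $x_0$; $\Pi(\mu,\nu)$ is the set of couplings; $\mathbb{R}_{++}^2$ is the set of vectors with strictly positive coordinates. $\boldsymbol{K}_\ell(\mu,\nu)=\inf_{\pi\in\Pi(\mu,\nu)}\int c_\ell\,d\pi$. For $\gamma\in\mathcal{P}(\mathcal{V})$, $\gamma_\ell$ is its projection on $\mathcal{S}_\ell$; $\Sigma_{\mathrm{D}}(\delta)=\{\gamma\in\mathcal{P}(\mathcal{V}):\boldsymbol{K}_1(\mu_1,\gamma_1)\le\delta_1,\ \boldsymbol{K}_2(\mu_2,\gamma_2)\le\delta_2\}$ and $\mathcal{I}_{\mathrm{D}}(\delta)=\sup_{\gamma\in\Sigma_{\mathrm{D}}(\delta)}\int_{\mathcal{V}} g\,d\gamma$, the supremum being over those $\gamma$ for which the integral is well defined in $[-\infty,\infty]$. *)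

theory Defs imports "HOL-Probability.Probability" begin

definition borel_probs :: "'a::topological_space measure set" where
  "borel_probs = {\<mu>. sets \<mu> = sets borel \<and> prob_space \<mu>}"

definition finite_moment_probs :: "real \<Rightarrow> 'a::polish_space measure set" where
  "finite_moment_probs p =
     {\<mu> \<in> borel_probs. \<exists>x0. (\<integral>\<^sup>+x. ennreal (dist x0 x powr p) \<partial>\<mu>) < \<infinity>}"

definition couplings ::
    "'a::polish_space measure \<Rightarrow> 'b::polish_space measure \<Rightarrow> ('a \<times> 'b) measure set" where
  "couplings \<mu> \<nu> =
     {\<pi> \<in> borel_probs. distr \<pi> borel fst = \<mu> \<and> distr \<pi> borel snd = \<nu>}"

definition metric_cost :: "real \<Rightarrow> 'a::polish_space \<Rightarrow> 'a \<Rightarrow> real" where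
  "metric_cost p s s' = dist s s' powr p"

text \<open>The optimal transport cost \<open>\<^bold>K\<close> for a nonnegative cost function \<open>c\<close>;
  the value may be infinite.\<close>

definition transport_cost ::
    "('a::polish_space \<Rightarrow> 'a \<Rightarrow> real) \<Rightarrow> 'a measure \<Rightarrow> 'a measure \<Rightarrow> ennreal" where
  "transport_cost c \<mu> \<nu> =
     (INF \<pi>\<in>couplings \<mu> \<nu>. \<integral>\<^sup>+z. ennreal (c (fst z) (snd z)) \<partial>\<pi>)"

text \<open>The integral of a real function with values in \<open>[-\<infinity>, \<infinity>]\<close>. Since
  \<^const>\<open>ennreal\<close> truncates negative reals to 0, \<open>ennreal (f x)\<close> and
  \<open>ennreal (- f x)\<close> are the positive and the negative part of \<open>f x\<close>. The value is
  meaningful only if the integral is well defined, that is, unless both parts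
  have infinite integral.\<close>

definition integral_well_defined :: "'a measure \<Rightarrow> ('a \<Rightarrow> real) \<Rightarrow> bool" where
  "integral_well_defined M f \<longleftrightarrow> f \<in> borel_measurable M \<and>
     ((\<integral>\<^sup>+x. ennreal (f x) \<partial>M) < \<infinity> \<or> (\<integral>\<^sup>+x. ennreal (- f x) \<partial>M) < \<infinity>)"

definition ext_integral :: "'a measure \<Rightarrow> ('a \<Rightarrow> real) \<Rightarrow> ereal" where
  "ext_integral M f =
     enn2ereal (\<integral>\<^sup>+x. ennreal (f x) \<partial>M) - enn2ereal (\<integral>\<^sup>+x. ennreal (- f x) \<partial>M)"

definition Sigma_D ::
    "('a::polish_space \<Rightarrow> 'a \<Rightarrow> real) \<Rightarrow> ('b::polish_space \<Rightarrow> 'b \<Rightarrow> real) \<Rightarrow>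
     'a measure \<Rightarrow> 'b measure \<Rightarrow> real \<times> real \<Rightarrow> ('a \<times> 'b) measure set" where
  "Sigma_D c1 c2 \<mu>1 \<mu>2 \<delta> =
     {\<gamma> \<in> borel_probs.
        transport_cost c1 \<mu>1 (distr \<gamma> borel fst) \<le> ennreal (fst \<delta>) \<and>
        transport_cost c2 \<mu>2 (distr \<gamma> borel snd) \<le> ennreal (snd \<delta>)}"

definition I_D ::
    "('a::polish_space \<Rightarrow> 'a \<Rightarrow> real) \<Rightarrow> ('b::polish_space \<Rightarrow> 'b \<Rightarrow> real) \<Rightarrow>
     'a measure \<Rightarrow> 'b measure \<Rightarrow> ('a \<times> 'b \<Rightarrow> real) \<Rightarrow> real \<times> real \<Rightarrow> ereal" where
  "I_D c1 c2 \<mu>1 \<mu>2 g \<delta> =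
     (SUP \<gamma>\<in>{\<gamma> \<in> Sigma_D c1 c2 \<mu>1 \<mu>2 \<delta>. integral_well_defined \<gamma> g}. ext_integral \<gamma> g)"

end

theory Submission imports Defs begin

text \<open>
  If \<open>g\<close> has the stated growth, then the triangle inequality bounds \<open>\<integral> g d\<gamma>\<close> by the
  moments of \<open>\<mu>1\<close> and \<open>\<mu>2\<close> and the transport costs. Conversely, moving an \<open>\<epsilon>\<close>-fraction of the
  mass of \<open>\<gamma>0\<close> to a single point \<open>v\<close> costs at most of order \<open>\<epsilon> * (1 + d1^p1 + d2^p2)\<close>. Hence
  \<open>\<epsilon> = C / (1 + d1^p1 + d2^p2)\<close> is affordable for a small \<open>C\<close> that does not depend on \<open>v\<close>,
  and \<open>\<epsilon> * g v - \<integral> g\<^sup>- d\<gamma>0 \<le> I_D\<close> is the growth bound.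
\<close>

text \<open>Measures on the product type carry \<open>borel\<close>, while the projections are
  naturally measurable for \<open>borel \<Otimes>\<^sub>M borel\<close>; second countability
  identifies the two sigma-algebras.\<close>

lemma borel_measurable_projections [measurable]:
  "(fst :: 'a::second_countable_topology \<times> 'b::second_countable_topology \<Rightarrow> 'a)
    \<in> borel_measurable borel"
  "(snd :: 'a \<times> 'b \<Rightarrow> 'b) \<in> borel_measurable borel"
  by (simp_all flip: borel_prod)

text \<open>The distance is at most twice the larger of the two legs, and the power of a maximum is
  one of the two powers. This costs the factor \<open>2 powr p\<close> but covers every p \<ge> 0
  without convexity.\<close>

lemma dist_powr_triangle:
  fixes a b c :: "'a::metric_space"
  assumes "p \<ge> 0"
  shows "dist a c powr p \<le> 2 powr p * (dist a b powr p + dist b c powr p)"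
proof -
  let ?m = "max (dist a b) (dist b c)"
  have "dist a c \<le> 2 * ?m"
    using dist_triangle[of a c b] by linarith
  then have "dist a c powr p \<le> (2 * ?m) powr p"
    using assms by (intro powr_mono2) auto
  also have "\<dots> = 2 powr p * ?m powr p"
    by (rule powr_mult)
  also have "?m powr p \<le> dist a b powr p + dist b c powr p"
    by (auto simp: max_def)
  finally show ?thesis
    by simp
qed

lemma nn_integral_dist_powr_triangle:
  fixes f h :: "'c \<Rightarrow> 'a::polish_space"
  assumes "p \<ge> 0" and [measurable]: "f \<in> borel_measurable M" "h \<in> borel_measurable M"
  shows "(\<integral>\<^sup>+x. ennreal (dist a (h x) powr p) \<partial>M) \<le>
    ennreal (2 powr p) * ((\<integral>\<^sup>+x. ennreal (dist a (f x) powr p) \<partial>M) +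
      (\<integral>\<^sup>+x. ennreal (dist (f x) (h x) powr p) \<partial>M))"
proof -
  have "(\<integral>\<^sup>+x. ennreal (dist a (h x) powr p) \<partial>M) \<le>
      (\<integral>\<^sup>+x. ennreal (2 powr p) *
        (ennreal (dist a (f x) powr p) + ennreal (dist (f x) (h x) powr p)) \<partial>M)"
    using dist_powr_triangle[OF assms(1)]
    by (intro nn_integral_mono) (simp flip: ennreal_plus ennreal_mult)
  also have "\<dots> = ennreal (2 powr p) * ((\<integral>\<^sup>+x. ennreal (dist a (f x) powr p) \<partial>M) +
      (\<integral>\<^sup>+x. ennreal (dist (f x) (h x) powr p) \<partial>M))"
    by (simp add: nn_integral_cmult nn_integral_add)
  finally show ?thesis .
qed

text \<open>Changing the centre from \<open>x0\<close> to \<open>a\<close> adds the constant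
  \<open>dist a x0 powr p\<close>, which has finite integral because the total mass is 1.\<close>

lemma finite_moment_any_point:
  fixes \<mu> :: "'a::polish_space measure"
  assumes "\<mu> \<in> finite_moment_probs p" and "p \<ge> 0"
  shows "(\<integral>\<^sup>+x. ennreal (dist a x powr p) \<partial>\<mu>) < \<infinity>"
proof -
  obtain x0 where x0: "(\<integral>\<^sup>+x. ennreal (dist x0 x powr p) \<partial>\<mu>) < \<infinity>"
    using assms(1) by (auto simp: finite_moment_probs_def)
  have [measurable_cong]: "sets \<mu> = sets borel" and "prob_space \<mu>"
    using assms(1) by (auto simp: finite_moment_probs_def borel_probs_def)
  interpret prob_space \<mu> by fact
  have "(\<integral>\<^sup>+x. ennreal (dist a x powr p) \<partial>\<mu>) \<le>
      ennreal (2 powr p) * ((\<integral>\<^sup>+x. ennreal (dist a x0 powr p) \<partial>\<mu>) +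
        (\<integral>\<^sup>+x. ennreal (dist x0 x powr p) \<partial>\<mu>))"
    by (rule nn_integral_dist_powr_triangle) (use assms in auto)
  also have "\<dots> < \<infinity>"
    using x0 by (simp add: ennreal_mult_less_top emeasure_space_1)
  finally show ?thesis .
qed

text \<open>Take a nearly optimal coupling and go from \<open>a\<close> to \<open>snd z\<close>
  through \<open>fst z\<close>: the first leg integrates to the moment of \<mu>, the second to the
  transport cost.\<close>

lemma moment_le_transport_cost:
  fixes \<mu> \<nu> :: "'a::polish_space measure"
  assumes "p \<ge> 0" "d \<ge> 0" and "transport_cost (metric_cost p) \<mu> \<nu> \<le> ennreal d"
  shows "(\<integral>\<^sup>+x. ennreal (dist a x powr p) \<partial>\<nu>) \<le>
    ennreal (2 powr p) * ((\<integral>\<^sup>+x. ennreal (dist a x powr p) \<partial>\<mu>) + ennreal (d + 1))"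
proof -
  \<comment> \<open>The slack 1 makes the inequality strict, so that the infimum yields an actual
    coupling of cost below \<open>d + 1\<close>.\<close>
  have "transport_cost (metric_cost p) \<mu> \<nu> < ennreal (d + 1)"
    using assms by (auto simp: ennreal_less_iff intro: le_less_trans)
  then obtain \<pi> where \<pi>: "\<pi> \<in> couplings \<mu> \<nu>"
    and cost: "(\<integral>\<^sup>+z. ennreal (metric_cost p (fst z) (snd z)) \<partial>\<pi>) < ennreal (d + 1)"
    unfolding transport_cost_def by (auto simp: INF_less_iff)
  have sets_\<pi>: "sets \<pi> = sets (borel \<Otimes>\<^sub>M borel)"
    and \<mu>: "\<mu> = distr \<pi> borel fst" and \<nu>: "\<nu> = distr \<pi> borel snd"
    using \<pi> unfolding couplings_def borel_probs_def borel_prod by blast+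
  note [measurable_cong] = sets_\<pi>
  have "(\<integral>\<^sup>+x. ennreal (dist a x powr p) \<partial>\<nu>) = (\<integral>\<^sup>+z. ennreal (dist a (snd z) powr p) \<partial>\<pi>)"
    unfolding \<nu> by (simp add: nn_integral_distr)
  also have "\<dots> \<le> ennreal (2 powr p) * ((\<integral>\<^sup>+z. ennreal (dist a (fst z) powr p) \<partial>\<pi>) +
      (\<integral>\<^sup>+z. ennreal (dist (fst z) (snd z) powr p) \<partial>\<pi>))"
    by (rule nn_integral_dist_powr_triangle) (use assms in auto)
  also have "(\<integral>\<^sup>+z. ennreal (dist a (fst z) powr p) \<partial>\<pi>) = (\<integral>\<^sup>+x. ennreal (dist a x powr p) \<partial>\<mu>)"
    unfolding \<mu> by (simp add: nn_integral_distr)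
  also have "(\<integral>\<^sup>+z. ennreal (dist (fst z) (snd z) powr p) \<partial>\<pi>) \<le> ennreal (d + 1)"
    using cost by (simp add: metric_cost_def)
  finally show ?thesis
    by (simp add: add_left_mono mult_left_mono)
qed

text \<open>For 0 \<le> \<epsilon> \<le> 1 and a Borel probability measure \<gamma> this is the
  mixture of the point mass at \<open>v\<close> with weight \<epsilon> and \<gamma> with weight 1 -
  \<epsilon>. It is realised by a coin and an independent sample, so that the original sample stays
  available for coupling.\<close>

definition point_mix :: "real \<Rightarrow> 'a::topological_space \<Rightarrow> 'a measure \<Rightarrow> 'a measure" where
  "point_mix \<epsilon> v \<gamma> =
     distr (measure_pmf (bernoulli_pmf \<epsilon>) \<Otimes>\<^sub>M \<gamma>) borel (\<lambda>(b, z). if b then v else z)"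

lemma nn_integral_bernoulli_pair:
  assumes "prob_space M" "0 \<le> \<epsilon>" "\<epsilon> \<le> 1"
    and "f \<in> borel_measurable (measure_pmf (bernoulli_pmf \<epsilon>) \<Otimes>\<^sub>M M)"
  shows "(\<integral>\<^sup>+x. f x \<partial>(measure_pmf (bernoulli_pmf \<epsilon>) \<Otimes>\<^sub>M M)) =
    ennreal \<epsilon> * (\<integral>\<^sup>+z. f (True, z) \<partial>M) + ennreal (1 - \<epsilon>) * (\<integral>\<^sup>+z. f (False, z) \<partial>M)"
proof -
  interpret prob_space M by fact
  show ?thesis
    using assms by (subst nn_integral_fst[symmetric]) (auto simp: mult.commute)
qed

lemma nn_integral_point_mix:
  assumes "prob_space \<gamma>" "sets \<gamma> = sets borel" "0 \<le> \<epsilon>" "\<epsilon> \<le> 1"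
    and [measurable]: "f \<in> borel_measurable borel"
  shows "(\<integral>\<^sup>+x. f x \<partial>point_mix \<epsilon> v \<gamma>) =
    ennreal \<epsilon> * f v + ennreal (1 - \<epsilon>) * (\<integral>\<^sup>+z. f z \<partial>\<gamma>)"
proof -
  note [measurable_cong] = assms(2)
  interpret prob_space \<gamma> by fact
  show ?thesis
    unfolding point_mix_def
    using assms(1,3,4)
    by (simp add: nn_integral_distr nn_integral_bernoulli_pair emeasure_space_1)
qed

lemma point_mix_borel_probs:
  assumes "\<gamma> \<in> borel_probs"
  shows "point_mix \<epsilon> v \<gamma> \<in> borel_probs"
proof -
  have [measurable_cong]: "sets \<gamma> = sets borel" and "prob_space \<gamma>"
    using assms by (auto simp: borel_probs_def)
  then interpret pair_prob_space "measure_pmf (bernoulli_pmf \<epsilon>)" \<gamma>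
    by (intro pair_prob_space.intro pair_sigma_finite.intro prob_space_imp_sigma_finite
        measure_pmf.prob_space_axioms)
  show ?thesis
    unfolding point_mix_def borel_probs_def by (auto intro!: prob_space_distr)
qed

text \<open>Couple the two laws through the same coin and sample: mass moves only when the coin
  selects \<open>v\<close>. The map \<open>f\<close> is arbitrary so that one mixture on the product
  can be treated under both projections.\<close>

lemma transport_cost_point_mix:
  fixes \<gamma> :: "'a::topological_space measure" and f :: "'a \<Rightarrow> 'b::polish_space"
  assumes "\<gamma> \<in> borel_probs" "0 \<le> \<epsilon>" "\<epsilon> \<le> 1" "p > 0"
    and [measurable]: "f \<in> borel_measurable borel"
  shows "transport_cost (metric_cost p) (distr \<gamma> borel f) (distr (point_mix \<epsilon> v \<gamma>) borel f)
    \<le> ennreal \<epsilon> * (\<integral>\<^sup>+x. ennreal (dist (f v) x powr p) \<partial>distr \<gamma> borel f)"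
proof -
  have [measurable_cong]: "sets \<gamma> = sets borel" and \<gamma>: "prob_space \<gamma>"
    using assms by (auto simp: borel_probs_def)
  interpret \<gamma>: prob_space \<gamma> by fact
  let ?N = "measure_pmf (bernoulli_pmf \<epsilon>) \<Otimes>\<^sub>M \<gamma>"
  interpret N: pair_prob_space "measure_pmf (bernoulli_pmf \<epsilon>)" \<gamma> ..
  define \<pi> where
    "\<pi> = distr ?N borel (\<lambda>(b, z). (f z, f (if b then v else z)))"
  have [measurable]: "(\<lambda>(b, z). (f z, f (if b then v else z))) \<in> borel_measurable ?N"
    by (subst borel_prod[symmetric]) measurable
  \<comment> \<open>Forgetting the coin recovers \<gamma>; this gives the first marginal of
    \<open>\<pi>\<close>.\<close>
  have "distr ?N \<gamma> snd = \<gamma>"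
  proof (rule measure_eqI)
    fix A assume "A \<in> sets (distr ?N \<gamma> snd)"
    then have A: "A \<in> sets \<gamma>" by simp
    have "emeasure (distr ?N \<gamma> snd) A = (\<integral>\<^sup>+x. indicator A x \<partial>distr ?N \<gamma> snd)"
      using A by simp
    also have "\<dots> = (\<integral>\<^sup>+x. indicator A (snd x) \<partial>?N)"
      using A by (subst nn_integral_distr) auto
    also have "\<dots> = ennreal \<epsilon> * emeasure \<gamma> A + ennreal (1 - \<epsilon>) * emeasure \<gamma> A"
      using A assms \<gamma> by (subst nn_integral_bernoulli_pair) auto
    also have "\<dots> = emeasure \<gamma> A"
      using assms by (simp flip: distrib_right ennreal_plus)
    finally show "emeasure (distr ?N \<gamma> snd) A = emeasure \<gamma> A" .
  qed simp
  then have "distr \<gamma> borel f = distr (distr ?N \<gamma> snd) borel f"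
    by simp
  then have fst: "distr \<pi> borel fst = distr \<gamma> borel f"
    unfolding \<pi>_def by (simp add: distr_distr comp_def case_prod_beta)
  have snd: "distr \<pi> borel snd = distr (point_mix \<epsilon> v \<gamma>) borel f"
    unfolding \<pi>_def point_mix_def by (simp add: distr_distr comp_def case_prod_beta)
  have "\<pi> \<in> couplings (distr \<gamma> borel f) (distr (point_mix \<epsilon> v \<gamma>) borel f)"
    using fst snd by (auto simp: couplings_def borel_probs_def \<pi>_def intro!: N.prob_space_distr)
  then have "transport_cost (metric_cost p) (distr \<gamma> borel f) (distr (point_mix \<epsilon> v \<gamma>) borel f)
      \<le> (\<integral>\<^sup>+z. ennreal (metric_cost p (fst z) (snd z)) \<partial>\<pi>)"
    unfolding transport_cost_def by (rule INF_lower)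
  \<comment> \<open>On the branch \<open>False\<close> both coordinates equal \<open>f z\<close> and
    the cost vanishes, so only the term with weight \<epsilon> survives.\<close>
  also have "\<dots> = ennreal \<epsilon> * (\<integral>\<^sup>+z. ennreal (dist (f z) (f v) powr p) \<partial>\<gamma>)"
  proof -
    have [measurable]: "(\<lambda>z. dist (fst z) (snd z :: 'b) powr p) \<in> borel_measurable borel"
      by (subst borel_prod[symmetric]) measurable
    show ?thesis
      unfolding \<pi>_def metric_cost_def
      using assms \<gamma> by (simp add: nn_integral_distr nn_integral_bernoulli_pair)
  qed
  also have "\<dots> = ennreal \<epsilon> * (\<integral>\<^sup>+x. ennreal (dist (f v) x powr p) \<partial>distr \<gamma> borel f)"
    by (simp add: nn_integral_distr dist_commute)
  finally show ?thesis .
qed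

text \<open>The moment about \<open>s\<close> grows at most linearly in 1 +
  \<open>dist a s powr p\<close>, and division by \<open>D\<close> cancels this growth, so one
  \<open>C\<close> serves all \<open>s\<close>. Only a lower bound on \<open>D\<close> is imposed
  because the same \<open>D\<close> must serve both coordinates of the product.\<close>

lemma scaled_moment_le:
  fixes \<mu> :: "'a::polish_space measure"
  assumes "\<mu> \<in> borel_probs" "p \<ge> 0" "A \<ge> 0" "C \<ge> 0"
    and A: "(\<integral>\<^sup>+x. ennreal (dist a x powr p) \<partial>\<mu>) = ennreal A"
    and D: "1 + dist a s powr p \<le> D" and d: "C * (2 powr p * (A + 1)) \<le> d"
  shows "ennreal (C / D) * (\<integral>\<^sup>+x. ennreal (dist s x powr p) \<partial>\<mu>) \<le> ennreal d"
proof -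
  have [measurable_cong]: "sets \<mu> = sets borel" and "prob_space \<mu>"
    using assms(1) by (auto simp: borel_probs_def)
  interpret prob_space \<mu> by fact
  define t where "t = dist a s powr p"
  have t: "t \<ge> 0" "1 + t \<le> D" "D > 0"
    using D powr_ge_zero[of "dist a s" p] unfolding t_def by linarith+
  have "(\<integral>\<^sup>+x. ennreal (dist s x powr p) \<partial>\<mu>) \<le>
      ennreal (2 powr p) * ((\<integral>\<^sup>+x. ennreal (dist s a powr p) \<partial>\<mu>) +
        (\<integral>\<^sup>+x. ennreal (dist a x powr p) \<partial>\<mu>))"
    by (rule nn_integral_dist_powr_triangle) (use assms in auto)
  also have "\<dots> = ennreal (2 powr p * (t + A))"
    using \<open>A \<ge> 0\<close>
    by (simp add: A emeasure_space_1 ennreal_mult ennreal_plus t_def dist_commute[of s a])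
  finally have "ennreal (C / D) * (\<integral>\<^sup>+x. ennreal (dist s x powr p) \<partial>\<mu>) \<le>
      ennreal (C / D) * ennreal (2 powr p * (t + A))"
    by (rule mult_left_mono) simp
  also have "\<dots> = ennreal (C / D * (2 powr p * (t + A)))"
    using assms t by (simp flip: ennreal_mult)
  also have "\<dots> \<le> ennreal d"
  proof (rule ennreal_leI)
    \<comment> \<open>The difference of the two sides is 1 + A t.\<close>
    have "t + A \<le> (A + 1) * (1 + t)"
      using t \<open>A \<ge> 0\<close> by (simp add: algebra_simps)
    also have "\<dots> \<le> (A + 1) * D"
      using t \<open>A \<ge> 0\<close> by (intro mult_left_mono) auto
    finally have "C * 2 powr p * (t + A) \<le> C * 2 powr p * ((A + 1) * D)"
      using assms by (intro mult_left_mono) auto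
    also have "\<dots> = C * (2 powr p * (A + 1)) * D"
      by simp
    also have "\<dots> \<le> d * D"
      using d t by (intro mult_right_mono) auto
    finally show "C / D * (2 powr p * (t + A)) \<le> d"
      using t by (simp add: field_simps)
  qed
  finally show ?thesis .
qed

theorem theorem4p1:
  fixes \<mu>1 :: "'a::polish_space measure" and \<mu>2 :: "'b::polish_space measure"
    and p1 p2 :: real and g :: "'a \<times> 'b \<Rightarrow> real"
  assumes "p1 \<ge> 1" and "p2 \<ge> 1"
    and "\<mu>1 \<in> finite_moment_probs p1" and "\<mu>2 \<in> finite_moment_probs p2"
    and "g \<in> borel_measurable borel"
    and "\<exists>\<gamma>0 \<in> couplings \<mu>1 \<mu>2. integral_well_defined \<gamma>0 g \<and> ext_integral \<gamma>0 g > -\<infinity>"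
  shows "\<forall>\<delta> :: real \<times> real. fst \<delta> > 0 \<and> snd \<delta> > 0 \<longrightarrow>
    (I_D (metric_cost p1) (metric_cost p2) \<mu>1 \<mu>2 g \<delta> < \<infinity> \<longleftrightarrow>
      (\<exists>s1' :: 'a. \<exists>s2' :: 'b. \<exists>M :: real. M > 0 \<and>
        (\<forall>s1 s2. g (s1, s2) \<le> M * (1 + dist s1' s1 powr p1 + dist s2' s2 powr p2))))"
proof (intro allI impI iffI)

  \<comment> \<open>Growth bound implies finiteness\<close>
  fix \<delta> :: "real \<times> real"
  assume \<delta>: "fst \<delta> > 0 \<and> snd \<delta> > 0"
  assume "\<exists>s1' s2' M. M > 0 \<and>
    (\<forall>s1 s2. g (s1, s2) \<le> M * (1 + dist s1' s1 powr p1 + dist s2' s2 powr p2))"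
  then obtain a b M where "M > 0"
    and growth: "\<And>s1 s2. g (s1, s2) \<le> M * (1 + dist a s1 powr p1 + dist b s2 powr p2)"
    by auto
  \<comment> \<open>\<open>K1\<close> and \<open>K2\<close> are the bounds of
    \<open>moment_le_transport_cost\<close> for the marginals, the same for every \<gamma> in
    \<open>Sigma_D\<close>.\<close>
  define K1 where "K1 = ennreal (2 powr p1) *
    ((\<integral>\<^sup>+x. ennreal (dist a x powr p1) \<partial>\<mu>1) + ennreal (fst \<delta> + 1))"
  define K2 where "K2 = ennreal (2 powr p2) *
    ((\<integral>\<^sup>+x. ennreal (dist b x powr p2) \<partial>\<mu>2) + ennreal (snd \<delta> + 1))"
  have "ext_integral \<gamma> g \<le> enn2ereal (ennreal M * (1 + K1 + K2))"
    if "\<gamma> \<in> Sigma_D (metric_cost p1) (metric_cost p2) \<mu>1 \<mu>2 \<delta>" for \<gamma>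
  proof -
    have sets_\<gamma>: "sets \<gamma> = sets (borel \<Otimes>\<^sub>M borel)" and "prob_space \<gamma>"
      and cost1: "transport_cost (metric_cost p1) \<mu>1 (distr \<gamma> borel fst) \<le> ennreal (fst \<delta>)"
      and cost2: "transport_cost (metric_cost p2) \<mu>2 (distr \<gamma> borel snd) \<le> ennreal (snd \<delta>)"
      using that unfolding Sigma_D_def borel_probs_def borel_prod by blast+
    note [measurable_cong] = sets_\<gamma>
    interpret prob_space \<gamma> by fact
    have "(\<integral>\<^sup>+z. ennreal (g z) \<partial>\<gamma>) \<le> (\<integral>\<^sup>+z. ennreal M *
        (1 + ennreal (dist a (fst z) powr p1) + ennreal (dist b (snd z) powr p2)) \<partial>\<gamma>)"
    proof (rule nn_integral_mono)
      fix z
      have "ennreal (g z) \<le> ennreal (M * (1 + dist a (fst z) powr p1 + dist b (snd z) powr p2))"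
        using growth[of "fst z" "snd z"] by (intro ennreal_leI) simp
      then show "ennreal (g z) \<le> ennreal M *
          (1 + ennreal (dist a (fst z) powr p1) + ennreal (dist b (snd z) powr p2))"
        using \<open>M > 0\<close> by (simp add: ennreal_mult ennreal_plus)
    qed
    also have "\<dots> = ennreal M * (1 + (\<integral>\<^sup>+x. ennreal (dist a x powr p1) \<partial>distr \<gamma> borel fst) +
        (\<integral>\<^sup>+x. ennreal (dist b x powr p2) \<partial>distr \<gamma> borel snd))"
      by (simp add: nn_integral_cmult nn_integral_add nn_integral_distr emeasure_space_1)
    also have "\<dots> \<le> ennreal M * (1 + K1 + K2)"
      unfolding K1_def K2_def using cost1 cost2 assms(1,2) \<delta>
      by (intro mult_left_mono add_mono moment_le_transport_cost order_refl) auto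
    finally have "enn2ereal (\<integral>\<^sup>+z. ennreal (g z) \<partial>\<gamma>) \<le> enn2ereal (ennreal M * (1 + K1 + K2))"
      by (simp add: less_eq_ennreal.rep_eq)
    \<comment> \<open>Subtracting the negative part only lowers the value, so the bound on the
      positive part suffices.\<close>
    then show ?thesis
      unfolding ext_integral_def
      by (rule order_trans[OF ereal_diff_le_self[OF enn2ereal_nonneg]])
  qed
  then have "I_D (metric_cost p1) (metric_cost p2) \<mu>1 \<mu>2 g \<delta> \<le>
      enn2ereal (ennreal M * (1 + K1 + K2))"
    unfolding I_D_def by (intro SUP_least) blast
  also have "K1 < \<infinity>" "K2 < \<infinity>"
    using finite_moment_any_point[OF assms(3), of a] finite_moment_any_point[OF assms(4), of b]
      assms(1,2)
    by (auto simp: K1_def K2_def ennreal_mult_less_top)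
  then have "ennreal M * (1 + K1 + K2) < top"
    by (simp add: ennreal_mult_less_top)
  then have "enn2ereal (ennreal M * (1 + K1 + K2)) < \<infinity>"
    by (simp add: less_ennreal.rep_eq top_ennreal.rep_eq)
  finally show "I_D (metric_cost p1) (metric_cost p2) \<mu>1 \<mu>2 g \<delta> < \<infinity>" .
next

  \<comment> \<open>Finiteness implies the growth bound\<close>
  fix \<delta> :: "real \<times> real"
  assume \<delta>: "fst \<delta> > 0 \<and> snd \<delta> > 0"
  let ?I = "I_D (metric_cost p1) (metric_cost p2) \<mu>1 \<mu>2 g \<delta>"
  assume "?I < \<infinity>"
  \<comment> \<open>The maximum with 0 gives a real bound even if \<open>?I\<close> is -\<infinity>,
    and \<open>B \<ge> 0\<close> later keeps the growth constant positive.\<close>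
  then obtain B where B: "?I \<le> ereal B" "B \<ge> 0"
    by (intro that[of "max 0 (real_of_ereal ?I)"]; cases ?I) auto
  obtain \<gamma>0 where \<gamma>0: "\<gamma>0 \<in> couplings \<mu>1 \<mu>2" "integral_well_defined \<gamma>0 g"
      "ext_integral \<gamma>0 g > -\<infinity>"
    using assms(6) by blast
  have probs: "\<gamma>0 \<in> borel_probs" "sets \<gamma>0 = sets borel" "prob_space \<gamma>0"
    and \<mu>: "distr \<gamma>0 borel fst = \<mu>1" "distr \<gamma>0 borel snd = \<mu>2"
    using \<gamma>0 by (auto simp: couplings_def borel_probs_def)
  note [measurable] = assms(5)
  \<comment> \<open>If the negative part were infinite, well-definedness would make the positive
    part finite and the integral would be -\<infinity>.\<close>
  have "(\<integral>\<^sup>+z. ennreal (- g z) \<partial>\<gamma>0) < \<infinity>"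
    using \<gamma>0(2,3)
    by (cases "\<integral>\<^sup>+z. ennreal (g z) \<partial>\<gamma>0"; cases "\<integral>\<^sup>+z. ennreal (- g z) \<partial>\<gamma>0")
      (auto simp: integral_well_defined_def ext_integral_def top_ennreal.rep_eq)
  then obtain Q where Q: "(\<integral>\<^sup>+z. ennreal (- g z) \<partial>\<gamma>0) = ennreal Q" "Q \<ge> 0"
    by (cases "\<integral>\<^sup>+z. ennreal (- g z) \<partial>\<gamma>0") auto
  \<comment> \<open>Any centres will do; they affect only the moments \<open>A1\<close>,
    \<open>A2\<close> and hence \<open>C\<close>.\<close>
  fix a :: 'a and b :: 'b
  obtain A1 where A1: "(\<integral>\<^sup>+x. ennreal (dist a x powr p1) \<partial>\<mu>1) = ennreal A1" "A1 \<ge> 0"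
    using finite_moment_any_point[OF assms(3), of a] assms(1)
    by (cases "\<integral>\<^sup>+x. ennreal (dist a x powr p1) \<partial>\<mu>1") auto
  obtain A2 where A2: "(\<integral>\<^sup>+x. ennreal (dist b x powr p2) \<partial>\<mu>2) = ennreal A2" "A2 \<ge> 0"
    using finite_moment_any_point[OF assms(4), of b] assms(2)
    by (cases "\<integral>\<^sup>+x. ennreal (dist b x powr p2) \<partial>\<mu>2") auto
  \<comment> \<open>The bound 1 ensures \<open>C / D \<le> 1\<close> for every
    \<open>D \<ge> 1\<close>; the two quotients are the budgets that \<open>scaled_moment_le\<close>
    asks for. None of them depends on the point \<open>(s1, s2)\<close>.\<close>
  define C where "C = min 1 (min (fst \<delta> / (2 powr p1 * (A1 + 1))) (snd \<delta> / (2 powr p2 * (A2 + 1))))"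
  have C: "0 < C" "C \<le> 1" "C * (2 powr p1 * (A1 + 1)) \<le> fst \<delta>" "C * (2 powr p2 * (A2 + 1)) \<le> snd \<delta>"
    using \<delta> A1(2) A2(2) by (auto simp: C_def simp flip: pos_le_divide_eq)
  \<comment> \<open>The constant comes from solving
    \<open>\<epsilon> * g (s1, s2) \<le> B + Q\<close> with \<epsilon> = \<open>C / D\<close>; the
    extra 1 makes it positive even when \<open>B\<close> and \<open>Q\<close> vanish. Where
    \<open>g\<close> is negative the bound is trivial.\<close>
  have "g (s1, s2) \<le> (B + Q + 1) / C * (1 + dist a s1 powr p1 + dist b s2 powr p2)" for s1 s2
  proof (cases "g (s1, s2) \<ge> 0")
    case True
    define D where "D = 1 + dist a s1 powr p1 + dist b s2 powr p2"
    define \<epsilon> where "\<epsilon> = C / D"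
    have D: "D \<ge> 1" "D \<ge> 1 + dist a s1 powr p1" "D \<ge> 1 + dist b s2 powr p2"
      by (auto simp: D_def)
    have \<epsilon>: "0 \<le> \<epsilon>" "\<epsilon> \<le> 1" "\<epsilon> > 0"
      using C D by (auto simp: \<epsilon>_def)
    let ?\<gamma> = "point_mix \<epsilon> (s1, s2) \<gamma>0"
    have "\<mu>1 \<in> borel_probs" "\<mu>2 \<in> borel_probs"
      using assms(3,4) by (auto simp: finite_moment_probs_def)
    have "transport_cost (metric_cost p1) \<mu>1 (distr ?\<gamma> borel fst)
        \<le> ennreal \<epsilon> * (\<integral>\<^sup>+x. ennreal (dist s1 x powr p1) \<partial>\<mu>1)"
      using transport_cost_point_mix[OF probs(1) \<epsilon>(1,2), of p1 fst "(s1, s2)"] assms(1)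
      by (simp add: \<mu>)
    also have "\<dots> \<le> ennreal (fst \<delta>)"
      unfolding \<epsilon>_def using \<open>\<mu>1 \<in> borel_probs\<close> A1 C D assms(1)
      by (intro scaled_moment_le[where a = a and A = A1]) simp_all
    finally have cost1: "transport_cost (metric_cost p1) \<mu>1 (distr ?\<gamma> borel fst) \<le> ennreal (fst \<delta>)" .
    have "transport_cost (metric_cost p2) \<mu>2 (distr ?\<gamma> borel snd)
        \<le> ennreal \<epsilon> * (\<integral>\<^sup>+x. ennreal (dist s2 x powr p2) \<partial>\<mu>2)"
      using transport_cost_point_mix[OF probs(1) \<epsilon>(1,2), of p2 snd "(s1, s2)"] assms(2)
      by (simp add: \<mu>)
    also have "\<dots> \<le> ennreal (snd \<delta>)"
      unfolding \<epsilon>_def using \<open>\<mu>2 \<in> borel_probs\<close> A2 C D assms(2)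
      by (intro scaled_moment_le[where a = b and A = A2]) simp_all
    finally have cost2: "transport_cost (metric_cost p2) \<mu>2 (distr ?\<gamma> borel snd) \<le> ennreal (snd \<delta>)" .
    have \<gamma>_Sigma: "?\<gamma> \<in> Sigma_D (metric_cost p1) (metric_cost p2) \<mu>1 \<mu>2 \<delta>"
      using probs cost1 cost2 by (simp add: Sigma_D_def point_mix_borel_probs)
    note mix = nn_integral_point_mix[OF probs(3,2) \<epsilon>(1,2), where v = "(s1, s2)"]
    \<comment> \<open>Since \<open>g (s1, s2) \<ge> 0\<close>, the added point mass contributes
      nothing to the negative part. That part is therefore finite, which makes the integral well
      defined and the mixture admissible in the supremum.\<close>
    have neg: "(\<integral>\<^sup>+z. ennreal (- g z) \<partial>?\<gamma>) = ennreal ((1 - \<epsilon>) * Q)"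
      using True Q \<epsilon> by (simp add: mix ennreal_neg ennreal_mult)
    \<comment> \<open>The share of \<open>\<gamma>0\<close> in the positive part is discarded,
      leaving only the point mass.\<close>
    have pos: "ennreal (\<epsilon> * g (s1, s2)) \<le> (\<integral>\<^sup>+z. ennreal (g z) \<partial>?\<gamma>)"
      using True \<epsilon> by (simp add: mix ennreal_mult)
    have "integral_well_defined ?\<gamma> g"
      by (simp add: integral_well_defined_def neg) (simp add: point_mix_def)
    then have "ext_integral ?\<gamma> g \<le> ?I"
      unfolding I_D_def using \<gamma>_Sigma by (intro SUP_upper) auto
    moreover have "ereal (\<epsilon> * g (s1, s2)) - ereal ((1 - \<epsilon>) * Q) \<le> ext_integral ?\<gamma> g"
      unfolding ext_integral_def neg
      using pos True Q \<epsilon>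
      by (intro ereal_minus_mono) (auto simp: less_eq_ennreal.rep_eq enn2ereal_ennreal)
    ultimately have "ereal (\<epsilon> * g (s1, s2) - (1 - \<epsilon>) * Q) \<le> ereal B"
      using B(1) by (simp flip: ereal_minus(1))
    then have "\<epsilon> * g (s1, s2) \<le> B + (1 - \<epsilon>) * Q"
      by simp
    also have "\<dots> \<le> B + Q + 1"
      using Q \<epsilon> by (simp add: algebra_simps add_increasing)
    finally show ?thesis
      using C D unfolding D_def[symmetric] by (simp add: \<epsilon>_def field_simps)
  next
    case False
    have "0 \<le> (B + Q + 1) / C * (1 + dist a s1 powr p1 + dist b s2 powr p2)"
      using B Q C by auto
    with False show ?thesis by linarith
  qed
  moreover have "(B + Q + 1) / C > 0"
    using B Q C by auto
  ultimately show "\<exists>s1' s2' M. M > 0 \<and>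
    (\<forall>s1 s2. g (s1, s2) \<le> M * (1 + dist s1' s1 powr p1 + dist s2' s2 powr p2))"
    by blast
qed

end
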